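(* Let $f(t)\in\mathbb{F}_2[t]$ be irreducible, $f(t)\neq t$, not self-reciprocal, and $R_f=\mathbb{F}_2[t,t^{-1},f(t)^{-1}]$. Then the group $\mathbf{A}_4(R_f)/Z(\mathbf{U}_4(R_f))$ has property $R_\infty$.
   Context: $\mathbf{A}_4(R)$ is the group of upper triangular $4\times4$ matrices over $R$ with diagonal $(1,u_2,u_3,1)$, $u_2,u_3\in U(R)$; $\mathbf{U}_4(R)$ is its subgroup of upper unitriangular matrices, with centre $Z(\mathbf{U}_4(R))=\{e_{1,4}(r): r\in R\}$ (matrices with $(1,4)$-entry $r$ and other off-diagonal entries zero). A group $G$ has property $R_\infty$ if every $\varphi\in\mathrm{Aut}(G)$ has infinitely many classes under $g\sim xg\varphi(x)^{-1}$. $f$ of degree $m$ is self-reciprocal if $t^mf(1/t)=f(t)$. *)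

theory Defs
  imports "HOL-Library.Z2" "HOL-Computational_Algebra.Polynomial"
    "HOL-Computational_Algebra.Fraction_Field" "HOL-Algebra.Coset"
begin

text \<open>Self-reciprocal: t^m f(1/t) = f(t), m = degree f, written out coefficientwise.\<close>
definition self_reciprocal :: "'a::comm_ring_1 poly \<Rightarrow> bool" where
  "self_reciprocal f \<longleftrightarrow> (\<Sum>i\<le>degree f. monom (coeff f i) (degree f - i)) = f"

definition Rf :: "bit poly \<Rightarrow> bit poly fract set" where
  "Rf f = {Fract g ([:0, 1:] ^ a * f ^ b) | g a b. True}"

definition ring_units :: "'a::comm_ring_1 set \<Rightarrow> 'a set" where
  "ring_units R = {u \<in> R. \<exists>v \<in> R. u * v = 1}"

text \<open>4x4 matrices as functions on indices 0..3 (zero outside).\<close>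
type_synonym 'a mat4 = "nat \<Rightarrow> nat \<Rightarrow> 'a"

definition mat4_mult :: "'a::comm_ring_1 mat4 \<Rightarrow> 'a mat4 \<Rightarrow> 'a mat4" where
  "mat4_mult A B = (\<lambda>i j. if i < 4 \<and> j < 4 then (\<Sum>k<4. A i k * B k j) else 0)"

definition mat4_one :: "'a::comm_ring_1 mat4" where
  "mat4_one = (\<lambda>i j. if i < 4 \<and> j < 4 \<and> i = j then 1 else 0)"

definition upper4_over :: "'a::comm_ring_1 set \<Rightarrow> 'a mat4 set" where
  "upper4_over R = {M. (\<forall>i j. (4 \<le> i \<or> 4 \<le> j) \<longrightarrow> M i j = 0)
      \<and> (\<forall>i j. j < i \<longrightarrow> M i j = 0) \<and> (\<forall>i<4. \<forall>j<4. M i j \<in> R)}"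

definition A4_carrier :: "'a::comm_ring_1 set \<Rightarrow> 'a mat4 set" where
  "A4_carrier R = {M \<in> upper4_over R. M 0 0 = 1 \<and> M 3 3 = 1
      \<and> M 1 1 \<in> ring_units R \<and> M 2 2 \<in> ring_units R}"

definition A4 :: "'a::comm_ring_1 set \<Rightarrow> 'a mat4 monoid" where
  "A4 R = \<lparr>carrier = A4_carrier R, mult = mat4_mult, one = mat4_one\<rparr>"

definition U4 :: "'a::comm_ring_1 set \<Rightarrow> 'a mat4 monoid" where
  "U4 R = \<lparr>carrier = {M \<in> upper4_over R. \<forall>i<4. M i i = 1},
           mult = mat4_mult, one = mat4_one\<rparr>"

definition group_center :: "('a, 'b) monoid_scheme \<Rightarrow> 'a set" where
  "group_center G = {z \<in> carrier G. \<forall>g \<in> carrier G. z \<otimes>\<^bsub>G\<^esub> g = g \<otimes>\<^bsub>G\<^esub> z}"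

definition twisted_conj :: "('a, 'b) monoid_scheme \<Rightarrow> ('a \<Rightarrow> 'a) \<Rightarrow> ('a \<times> 'a) set" where
  "twisted_conj G \<phi> = {(g, h). g \<in> carrier G \<and> h \<in> carrier G \<and>
      (\<exists>x \<in> carrier G. h = x \<otimes>\<^bsub>G\<^esub> g \<otimes>\<^bsub>G\<^esub> inv\<^bsub>G\<^esub> (\<phi> x))}"

definition R_infinity :: "('a, 'b) monoid_scheme \<Rightarrow> bool" where
  "R_infinity G \<longleftrightarrow> (\<forall>\<phi> \<in> iso G G. infinite (carrier G // twisted_conj G \<phi>))"

end

theory Submission
  imports Defs "HOL-Computational_Algebra.Polynomial_Factorial"
begin

text \<open>The idea: every automorphism \<open>\<phi>\<close> of the quotient preserves the character \<open>u\<^sub>2 / u\<^sub>3\<close> with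
  values in the infinite group of units of \<open>R\<^sub>f\<close>, so that this character separates infinitely many
  twisted conjugacy classes. Indeed \<open>\<phi>\<close> preserves, modulo the centre of the unipotent radical, the
  root subgroup \<open>e\<^sub>2\<^sub>,\<^sub>3(R\<^sub>f)\<close>, on which the group acts through this character. The induced additive
  map of \<open>R\<^sub>f\<close> is therefore semilinear over an automorphism of the unit group \<open>{t\<^sup>i f\<^sup>j}\<close>, which extends
  to a ring automorphism of \<open>R\<^sub>f\<close>. A ring automorphism permutes the places \<open>0\<close>, \<open>\<infinity>\<close> and \<open>f\<close>; it
  fixes \<open>f\<close>, whose degree is at least 2, and could only exchange \<open>0\<close> and \<open>\<infinity>\<close> if \<open>f\<close> were
  self-reciprocal.\<close>

subsection \<open>The quotient group in coordinates\<close>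

text \<open>If \<open>\<chi>\<close> is a character fixed by \<open>\<phi>\<close>, the factors
  \<open>\<chi> x\<close> and \<open>\<chi> (\<phi> x)\<close> cancel in the value at
  \<open>x g \<phi>(x)^-1\<close>. So \<open>\<chi>\<close> is constant on each class, and
  infinitely many values force infinitely many classes.\<close>

lemma R_infinityI:
  fixes G :: "('a, 'b) monoid_scheme" and \<chi> :: "'a \<Rightarrow> 'c::field"
  assumes "group G"
    and mult: "\<And>x y. x \<in> carrier G \<Longrightarrow> y \<in> carrier G \<Longrightarrow> \<chi> (x \<otimes>\<^bsub>G\<^esub> y) = \<chi> x * \<chi> y"
    and nz: "\<And>x. x \<in> carrier G \<Longrightarrow> \<chi> x \<noteq> 0"
    and inf: "infinite (\<chi> ` carrier G)"
    and inv: "\<And>\<phi> x. \<phi> \<in> iso G G \<Longrightarrow> x \<in> carrier G \<Longrightarrow> \<chi> (\<phi> x) = \<chi> x"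
  shows "R_infinity G"
  unfolding R_infinity_def
proof (intro ballI notI)
  fix \<phi> assume phi: "\<phi> \<in> iso G G" and fin: "finite (carrier G // twisted_conj G \<phi>)"
  interpret group G by fact
  have closed: "\<phi> x \<in> carrier G" if "x \<in> carrier G" for x
    using phi that by (auto simp: iso_def hom_def)
  have class_const: "\<chi> h = \<chi> g" if gh: "(g, h) \<in> twisted_conj G \<phi>" for g h
  proof -
    obtain x where x: "x \<in> carrier G" "g \<in> carrier G" "h = x \<otimes>\<^bsub>G\<^esub> g \<otimes>\<^bsub>G\<^esub> inv\<^bsub>G\<^esub> (\<phi> x)"
      using gh by (auto simp: twisted_conj_def)
    have "h \<otimes>\<^bsub>G\<^esub> \<phi> x = x \<otimes>\<^bsub>G\<^esub> g" and "h \<in> carrier G"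
      using x closed by (simp_all add: m_assoc)
    then have "\<chi> h * \<chi> (\<phi> x) = \<chi> x * \<chi> g"
      using mult x closed by metis
    then show ?thesis using inv[OF phi x(1)] nz[OF x(1)] by simp
  qed
  \<comment> \<open>Reflexivity, with conjugator \<open>1\<close>, makes every class nonempty, so
    \<open>SOME\<close> below picks a genuine member.\<close>
  have self: "(g, g) \<in> twisted_conj G \<phi>" if "g \<in> carrier G" for g
  proof -
    have "\<phi> \<one>\<^bsub>G\<^esub> = \<one>\<^bsub>G\<^esub>"
      using phi hom_one[of \<phi> G G] is_group by (auto simp: iso_def)
    then show ?thesis using that
      by (auto simp: twisted_conj_def intro!: bexI[of _ "\<one>\<^bsub>G\<^esub>"])
  qed
  have "\<chi> ` carrier G \<subseteq> (\<lambda>X. \<chi> (SOME h. h \<in> X)) ` (carrier G // twisted_conj G \<phi>)"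
  proof
    fix y assume "y \<in> \<chi> ` carrier G"
    then obtain g where g: "g \<in> carrier G" "y = \<chi> g" by auto
    let ?X = "twisted_conj G \<phi> `` {g}"
    have "(SOME h. h \<in> ?X) \<in> ?X"
      using self[OF g(1)] by (intro someI[of "\<lambda>h. h \<in> ?X" g]) auto
    then have "\<chi> (SOME h. h \<in> ?X) = y"
      using class_const g by auto
    then show "y \<in> (\<lambda>X. \<chi> (SOME h. h \<in> X)) ` (carrier G // twisted_conj G \<phi>)"
      using g(1) by (auto simp: quotient_def intro!: rev_image_eqI[of ?X])
  qed
  then show False using fin inf by (meson finite_imageI finite_subset)
qed

locale subring_of_field =
  fixes R :: "'a::field set"
  assumes zero_R: "0 \<in> R" and one_R: "1 \<in> R"
    and add_R: "x \<in> R \<Longrightarrow> y \<in> R \<Longrightarrow> x + y \<in> R"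
    and uminus_R: "x \<in> R \<Longrightarrow> - x \<in> R"
    and mult_R: "x \<in> R \<Longrightarrow> y \<in> R \<Longrightarrow> x * y \<in> R"
begin

lemma ring_units_iff: "u \<in> ring_units R \<longleftrightarrow> u \<in> R \<and> u \<noteq> 0 \<and> inverse u \<in> R"
proof
  assume "u \<in> ring_units R"
  then obtain v where "u \<in> R" "v \<in> R" "u * v = 1" by (auto simp: ring_units_def)
  moreover have "inverse u = v" using \<open>u * v = 1\<close> by (rule inverse_unique)
  ultimately show "u \<in> R \<and> u \<noteq> 0 \<and> inverse u \<in> R" by auto
qed (auto simp: ring_units_def intro!: bexI[of _ "inverse u"])

end

text \<open>The arguments are ordered by distance from the diagonal: \<open>u, v\<close>, then
  \<open>a, b, c\<close>, then \<open>d, e\<close>, and last the corner \<open>x\<close>. A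
  coordinate of a product involves no coordinate farther from the diagonal, so discarding
  \<open>x\<close> is compatible with multiplication.\<close>

definition tri4 :: "'a::comm_ring_1 \<Rightarrow> 'a \<Rightarrow> 'a \<Rightarrow> 'a \<Rightarrow> 'a \<Rightarrow> 'a \<Rightarrow> 'a \<Rightarrow> 'a \<Rightarrow> 'a mat4" where
  "tri4 u v a b c d e x = (\<lambda>i j.
     if i = 0 then (if j = 0 then 1 else if j = 1 then a else if j = 2 then d else if j = 3 then x else 0)
     else if i = 1 then (if j = 1 then u else if j = 2 then b else if j = 3 then e else 0)
     else if i = 2 then (if j = 2 then v else if j = 3 then c else 0)
     else if i = 3 \<and> j = 3 then 1 else 0)"

lemma tri4_eq_iff:
  "tri4 u v a b c d e x = tri4 u' v' a' b' c' d' e' x' \<longleftrightarrow>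
     u = u' \<and> v = v' \<and> a = a' \<and> b = b' \<and> c = c' \<and> d = d' \<and> e = e' \<and> x = x'"
proof
  assume eq: "tri4 u v a b c d e x = tri4 u' v' a' b' c' d' e' x'"
  show "u = u' \<and> v = v' \<and> a = a' \<and> b = b' \<and> c = c' \<and> d = d' \<and> e = e' \<and> x = x'"
    using fun_cong[OF fun_cong[OF eq, of 1], of 1] fun_cong[OF fun_cong[OF eq, of 2], of 2]
      fun_cong[OF fun_cong[OF eq, of 0], of 1] fun_cong[OF fun_cong[OF eq, of 1], of 2]
      fun_cong[OF fun_cong[OF eq, of 2], of 3] fun_cong[OF fun_cong[OF eq, of 0], of 2]
      fun_cong[OF fun_cong[OF eq, of 1], of 3] fun_cong[OF fun_cong[OF eq, of 0], of 3]
    by (simp add: tri4_def)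
qed simp

lemma less_4_iff: "(i::nat) < 4 \<longleftrightarrow> i = 0 \<or> i = 1 \<or> i = 2 \<or> i = 3"
  by auto

lemma mat4_mult_tri4:
  "mat4_mult (tri4 u v a b c d e x) (tri4 u' v' a' b' c' d' e' x') =
   tri4 (u * u') (v * v') (a' + a * u') (u * b' + b * v') (v * c' + c)
     (d' + a * b' + d * v') (u * e' + b * c' + e) (x' + a * e' + d * c' + x)"
proof (intro ext)
  fix i j :: nat
  have sum4: "(\<Sum>k<4. h k) = h 0 + h 1 + h 2 + h 3" for h :: "nat \<Rightarrow> 'a"
    by (simp add: numeral_eq_Suc)
  show "mat4_mult (tri4 u v a b c d e x) (tri4 u' v' a' b' c' d' e' x') i j =
   tri4 (u * u') (v * v') (a' + a * u') (u * b' + b * v') (v * c' + c)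
     (d' + a * b' + d * v') (u * e' + b * c' + e) (x' + a * e' + d * c' + x) i j"
    unfolding mat4_mult_def sum4 by (auto simp: tri4_def)
qed

lemma mat4_one_eq_tri4: "mat4_one = tri4 1 1 0 0 0 0 0 0"
  by (intro ext) (auto simp: mat4_one_def tri4_def)

lemma upper4_eq_tri4:
  assumes "M \<in> upper4_over R" "M 0 0 = 1" "M 3 3 = 1"
  shows "M = tri4 (M 1 1) (M 2 2) (M 0 1) (M 1 2) (M 2 3) (M 0 2) (M 1 3) (M 0 3)"
proof (intro ext)
  fix i j
  have *: "\<And>i j. 4 \<le> i \<or> 4 \<le> j \<Longrightarrow> M i j = 0" "\<And>i j. j < i \<Longrightarrow> M i j = 0"
    using assms(1) by (auto simp: upper4_over_def)
  show "M i j = tri4 (M 1 1) (M 2 2) (M 0 1) (M 1 2) (M 2 3) (M 0 2) (M 1 3) (M 0 3) i j"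
  proof (cases "i < 4 \<and> j < 4")
    case True
    then show ?thesis using assms(2,3)
      unfolding less_4_iff by (auto simp: tri4_def *(2))
  next
    case False
    then show ?thesis using *(1)[of i j] by (auto simp: tri4_def)
  qed
qed

definition quo_mult ::
  "'a::field \<times> 'a \<times> 'a \<times> 'a \<times> 'a \<times> 'a \<times> 'a \<Rightarrow> 'a \<times> 'a \<times> 'a \<times> 'a \<times> 'a \<times> 'a \<times> 'a \<Rightarrow>
   'a \<times> 'a \<times> 'a \<times> 'a \<times> 'a \<times> 'a \<times> 'a" where
  "quo_mult = (\<lambda>(u, v, a, b, c, d, e) (u', v', a', b', c', d', e').
     (u * u', v * v', a' + a * u', u * b' + b * v', v * c' + c,
      d' + a * b' + d * v', u * e' + b * c' + e))"

lemma quo_mult_simps: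
  "quo_mult (u, v, a, b, c, d, e) (u', v', a', b', c', d', e') =
     (u * u', v * v', a' + a * u', u * b' + b * v', v * c' + c,
      d' + a * b' + d * v', u * e' + b * c' + e)"
  by (simp add: quo_mult_def)

text \<open>The tuple \<open>(u, v, a, b, c, d, e)\<close> stands for the class modulo \<open>e\<^sub>1\<^sub>,\<^sub>4(R)\<close> of the matrix with
  rows \<open>(1, a, d, *)\<close>, \<open>(0, u, b, e)\<close>, \<open>(0, 0, v, c)\<close>, \<open>(0, 0, 0, 1)\<close>.\<close>

definition quo4 :: "'a::field set \<Rightarrow> ('a \<times> 'a \<times> 'a \<times> 'a \<times> 'a \<times> 'a \<times> 'a) monoid" where
  "quo4 R = \<lparr>carrier = ring_units R \<times> ring_units R \<times> R \<times> R \<times> R \<times> R \<times> R,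
             mult = quo_mult, one = (1, 1, 0, 0, 0, 0, 0)\<rparr>"

lemma quo4_sel [simp]:
  "carrier (quo4 R) = ring_units R \<times> ring_units R \<times> R \<times> R \<times> R \<times> R \<times> R"
  "x \<otimes>\<^bsub>quo4 R\<^esub> y = quo_mult x y"
  "\<one>\<^bsub>quo4 R\<^esub> = (1, 1, 0, 0, 0, 0, 0)"
  by (simp_all add: quo4_def)

definition to_quo4 :: "'a::field mat4 \<Rightarrow> 'a \<times> 'a \<times> 'a \<times> 'a \<times> 'a \<times> 'a \<times> 'a" where
  "to_quo4 M = (M 1 1, M 2 2, M 0 1, M 1 2, M 2 3, M 0 2, M 1 3)"

lemma to_quo4_tri4: "to_quo4 (tri4 u v a b c d e x) = (u, v, a, b, c, d, e)"
  by (simp add: to_quo4_def tri4_def)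

text \<open>The character by which conjugation scales the root subgroup \<open>e_{2,3}\<close>
  modulo the centre of the unipotent radical.\<close>

definition root_ratio :: "'a::field \<times> 'a \<times> 'b \<Rightarrow> 'a" where
  "root_ratio = (\<lambda>(u, v, _). u / v)"

lemma root_ratio_simps: "root_ratio (u, v, y) = u / v"
  by (simp add: root_ratio_def)

context subring_of_field
begin

lemma tri4_in_upper4:
  assumes "u \<in> R" "v \<in> R" "a \<in> R" "b \<in> R" "c \<in> R" "d \<in> R" "e \<in> R" "x \<in> R"
  shows "tri4 u v a b c d e x \<in> upper4_over R"
  using assms zero_R one_R by (auto simp: upper4_over_def tri4_def)

lemma A4_carrier_eq:
  "A4_carrier R = {tri4 u v a b c d e x | u v a b c d e x. u \<in> ring_units R \<and> v \<in> ring_units R \<and>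
     a \<in> R \<and> b \<in> R \<and> c \<in> R \<and> d \<in> R \<and> e \<in> R \<and> x \<in> R}" (is "_ = ?S")
proof
  show "A4_carrier R \<subseteq> ?S"
  proof
    fix M assume M: "M \<in> A4_carrier R"
    then have eq: "M = tri4 (M 1 1) (M 2 2) (M 0 1) (M 1 2) (M 2 3) (M 0 2) (M 1 3) (M 0 3)"
      by (intro upper4_eq_tri4) (auto simp: A4_carrier_def)
    have "\<forall>i<4. \<forall>j<4. M i j \<in> R" "M 1 1 \<in> ring_units R" "M 2 2 \<in> ring_units R"
      using M by (auto simp: A4_carrier_def upper4_over_def)
    then show "M \<in> ?S"
      by - (intro CollectI exI conjI, rule eq, simp_all)
  qed
  show "?S \<subseteq> A4_carrier R"
  proof
    fix M assume "M \<in> ?S"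
    then obtain u v a b c d e x where M: "M = tri4 u v a b c d e x"
      and *: "u \<in> ring_units R" "v \<in> ring_units R" "a \<in> R" "b \<in> R" "c \<in> R" "d \<in> R" "e \<in> R" "x \<in> R"
      by blast
    then have "M \<in> upper4_over R"
      using tri4_in_upper4 by (simp add: ring_units_iff)
    then show "M \<in> A4_carrier R"
      using * by (simp add: A4_carrier_def M) (simp add: tri4_def)
  qed
qed

lemma A4_carrierE:
  assumes "M \<in> A4_carrier R"
  obtains u v a b c d e x where "M = tri4 u v a b c d e x" "u \<in> ring_units R" "v \<in> ring_units R"
    "a \<in> R" "b \<in> R" "c \<in> R" "d \<in> R" "e \<in> R" "x \<in> R"
  using assms unfolding A4_carrier_eq by blast

lemma tri4_in_A4_iff:
  "tri4 u v a b c d e x \<in> A4_carrier R \<longleftrightarrow> u \<in> ring_units R \<and> v \<in> ring_units R \<and>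
     a \<in> R \<and> b \<in> R \<and> c \<in> R \<and> d \<in> R \<and> e \<in> R \<and> x \<in> R"
  unfolding A4_carrier_eq by (auto simp: tri4_eq_iff)

lemma ring_units_one: "1 \<in> ring_units R"
  by (simp add: ring_units_iff one_R)

lemma ring_units_mult: "u \<in> ring_units R \<Longrightarrow> v \<in> ring_units R \<Longrightarrow> u * v \<in> ring_units R"
  by (simp add: ring_units_iff mult_R)

lemma ring_units_inverse: "u \<in> ring_units R \<Longrightarrow> inverse u \<in> ring_units R"
  by (simp add: ring_units_iff)

lemma ring_units_in_R: "u \<in> ring_units R \<Longrightarrow> u \<in> R"
  by (simp add: ring_units_iff)

lemma ring_units_nz: "u \<in> ring_units R \<Longrightarrow> u \<noteq> 0"
  by (simp add: ring_units_iff)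

lemma diff_R: "x \<in> R \<Longrightarrow> y \<in> R \<Longrightarrow> x - y \<in> R"
  using add_R[of x "- y"] uminus_R by simp

lemmas R_closed = zero_R one_R add_R uminus_R diff_R mult_R
  ring_units_one ring_units_mult ring_units_inverse ring_units_in_R

lemma group_A4: "group (A4 R)"
proof (rule groupI)
  fix M N assume "M \<in> carrier (A4 R)" "N \<in> carrier (A4 R)"
  then show "M \<otimes>\<^bsub>A4 R\<^esub> N \<in> carrier (A4 R)"
    by (auto simp: A4_def mat4_mult_tri4 tri4_in_A4_iff R_closed
        elim!: A4_carrierE)
next
  fix M N L assume "M \<in> carrier (A4 R)" "N \<in> carrier (A4 R)" "L \<in> carrier (A4 R)"
  then show "M \<otimes>\<^bsub>A4 R\<^esub> N \<otimes>\<^bsub>A4 R\<^esub> L = M \<otimes>\<^bsub>A4 R\<^esub> (N \<otimes>\<^bsub>A4 R\<^esub> L)"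
    by (auto simp: A4_def mat4_mult_tri4 tri4_eq_iff algebra_simps elim!: A4_carrierE)
next
  show "\<one>\<^bsub>A4 R\<^esub> \<in> carrier (A4 R)"
    by (simp add: A4_def mat4_one_eq_tri4 tri4_in_A4_iff R_closed)
next
  fix M assume "M \<in> carrier (A4 R)"
  then show "\<one>\<^bsub>A4 R\<^esub> \<otimes>\<^bsub>A4 R\<^esub> M = M"
    by (auto simp: A4_def mat4_one_eq_tri4 mat4_mult_tri4 elim!: A4_carrierE)
next
  fix M assume "M \<in> carrier (A4 R)"
  then obtain u v a b c d e x where M: "M = tri4 u v a b c d e x"
    and *: "u \<in> ring_units R" "v \<in> ring_units R" "a \<in> R" "b \<in> R" "c \<in> R" "d \<in> R" "e \<in> R" "x \<in> R"
    by (auto simp: A4_def elim!: A4_carrierE)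
  have nz: "u \<noteq> 0" "v \<noteq> 0" using * ring_units_nz by auto
  \<comment> \<open>The left inverse by substitution: each entry is solved from those nearer to the
    diagonal.\<close>
  define a' where "a' = - a * inverse u"
  define b' where "b' = - (inverse u * b * inverse v)"
  define c' where "c' = - (inverse v * c)"
  define d' where "d' = - (d + a' * b) * inverse v"
  define e' where "e' = - (inverse u * e + b' * c)"
  define x' where "x' = - (x + a' * e + d' * c)"
  let ?N = "tri4 (inverse u) (inverse v) a' b' c' d' e' x'"
  have "a' \<in> R" "b' \<in> R" "c' \<in> R"
    using * by (simp_all add: a'_def b'_def c'_def R_closed)
  moreover from this have "d' \<in> R" "e' \<in> R"
    using * by (simp_all add: d'_def e'_def R_closed)
  moreover from calculation have "x' \<in> R"
    using * by (simp add: x'_def R_closed)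
  ultimately have "?N \<in> A4_carrier R"
    using * by (simp add: tri4_in_A4_iff R_closed)
  moreover have "mat4_mult ?N M = mat4_one"
    unfolding M mat4_mult_tri4 mat4_one_eq_tri4 tri4_eq_iff
    using nz by (simp add: a'_def b'_def c'_def d'_def e'_def x'_def mult.assoc)
  ultimately show "\<exists>N\<in>carrier (A4 R). N \<otimes>\<^bsub>A4 R\<^esub> M = \<one>\<^bsub>A4 R\<^esub>"
    by (auto simp: A4_def)
qed

lemma to_quo4_mult:
  assumes "M \<in> A4_carrier R" "N \<in> A4_carrier R"
  shows "to_quo4 (mat4_mult M N) = quo_mult (to_quo4 M) (to_quo4 N)"
  using assms by (auto simp: mat4_mult_tri4 to_quo4_tri4 quo_mult_simps elim!: A4_carrierE)

lemma to_quo4_surj: "to_quo4 ` A4_carrier R = carrier (quo4 R)"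
proof (intro equalityI subsetI)
  fix y assume "y \<in> carrier (quo4 R)"
  then obtain u v a b c d e where "y = (u, v, a, b, c, d, e)" "u \<in> ring_units R"
    "v \<in> ring_units R" "a \<in> R" "b \<in> R" "c \<in> R" "d \<in> R" "e \<in> R" by auto
  then show "y \<in> to_quo4 ` A4_carrier R"
    by (intro rev_image_eqI[of "tri4 u v a b c d e 0"]) (auto simp: tri4_in_A4_iff to_quo4_tri4 zero_R)
qed (auto simp: to_quo4_tri4 elim!: A4_carrierE)

lemma to_quo4_hom: "to_quo4 \<in> hom (A4 R) (quo4 R)"
  using to_quo4_mult to_quo4_surj by (auto simp: hom_def A4_def simp del: quo4_sel(1))

lemma group_quo4: "group (quo4 R)"
proof -
  interpret A: group "A4 R" by (rule group_A4)
  have "group (quo4 R\<lparr>carrier := to_quo4 ` carrier (A4 R), one := to_quo4 \<one>\<^bsub>A4 R\<^esub>\<rparr>)"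
    by (rule A.hom_imp_img_group[OF to_quo4_hom])
  moreover have "quo4 R\<lparr>carrier := to_quo4 ` carrier (A4 R), one := to_quo4 \<one>\<^bsub>A4 R\<^esub>\<rparr> = quo4 R"
    using to_quo4_surj by (simp add: A4_def mat4_one_eq_tri4 to_quo4_tri4 quo4_def)
  ultimately show ?thesis by simp
qed

text \<open>Both sides consist of the matrices \<open>e_{1,4}(r)\<close>. With this, the first
  isomorphism theorem for \<open>to_quo4\<close> turns the quotient by the centre into
  \<open>quo4 R\<close>.\<close>

lemma group_center_U4: "group_center (U4 R) = kernel (A4 R) (quo4 R) to_quo4"
proof (intro equalityI subsetI)
  have U4: "tri4 1 1 a b c d e x \<in> carrier (U4 R)"
    if "a \<in> R" "b \<in> R" "c \<in> R" "d \<in> R" "e \<in> R" "x \<in> R" for a b c d e x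
    using that tri4_in_upper4[of 1 1 a b c d e x] one_R
    by (auto simp: U4_def less_4_iff tri4_def)
  fix M assume M: "M \<in> group_center (U4 R)"
  then have "M \<in> upper4_over R" and diag: "M 0 0 = 1" "M 1 1 = 1" "M 2 2 = 1" "M 3 3 = 1"
    by (auto simp: group_center_def U4_def)
  then obtain a b c d e x where Meq: "M = tri4 1 1 a b c d e x"
    using upper4_eq_tri4[of M R] by metis
  moreover have "a \<in> R" "b \<in> R" "c \<in> R" "d \<in> R" "e \<in> R" "x \<in> R"
  proof -
    have *: "M i j \<in> R" if "i < 4" "j < 4" for i j
      using \<open>M \<in> upper4_over R\<close> that by (auto simp: upper4_over_def)
    show "a \<in> R" "b \<in> R" "c \<in> R" "d \<in> R" "e \<in> R" "x \<in> R"
      using *[of 0 1] *[of 1 2] *[of 2 3] *[of 0 2] *[of 1 3] *[of 0 3]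
      by (simp_all add: Meq tri4_def)
  qed
  moreover have comm: "mat4_mult M N = mat4_mult N M" if "N \<in> carrier (U4 R)" for N
    using M that by (auto simp: group_center_def U4_def)
  \<comment> \<open>Commuting with \<open>e_{1,2}(1)\<close> kills \<open>b\<close> and
    \<open>e\<close>, with \<open>e_{2,3}(1)\<close> kills \<open>a\<close> and \<open>c\<close>,
    with \<open>e_{3,4}(1)\<close> kills \<open>b\<close> and \<open>d\<close>.\<close>
  have "a = 0 \<and> b = 0 \<and> c = 0 \<and> d = 0 \<and> e = 0"
    using comm[OF U4[of 1 0 0 0 0 0]] comm[OF U4[of 0 1 0 0 0 0]] comm[OF U4[of 0 0 1 0 0 0]]
    by (auto simp: Meq mat4_mult_tri4 tri4_eq_iff zero_R one_R)
  ultimately show "M \<in> kernel (A4 R) (quo4 R) to_quo4"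
    by (auto simp: kernel_def A4_def tri4_in_A4_iff to_quo4_tri4 R_closed)
next
  fix M assume "M \<in> kernel (A4 R) (quo4 R) to_quo4"
  then obtain x where M: "M = tri4 1 1 0 0 0 0 0 x" "x \<in> R"
    by (auto simp: kernel_def A4_def to_quo4_tri4 elim!: A4_carrierE)
  have "M \<in> carrier (U4 R)"
    using M tri4_in_upper4[of 1 1 0 0 0 0 0 x] zero_R one_R
    by (auto simp: U4_def less_4_iff tri4_def)
  moreover have "mat4_mult M N = mat4_mult N M" if "N \<in> carrier (U4 R)" for N
  proof -
    have N: "N \<in> upper4_over R" "N 0 0 = 1" "N 1 1 = 1" "N 2 2 = 1" "N 3 3 = 1"
      using that by (auto simp: U4_def)
    obtain a b c d e y where Neq: "N = tri4 1 1 a b c d e y"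
      using upper4_eq_tri4[OF N(1,2,5)] N by metis
    show ?thesis by (simp add: Neq M mat4_mult_tri4 add.commute)
  qed
  ultimately show "M \<in> group_center (U4 R)"
    by (auto simp: group_center_def U4_def)
qed

lemma A4_quotient_iso:
  obtains \<psi> where "\<psi> \<in> iso (A4 R Mod group_center (U4 R)) (quo4 R)"
    and "group (A4 R Mod group_center (U4 R))"
proof -
  interpret group_hom "A4 R" "quo4 R" to_quo4
    using group_A4 group_quo4 to_quo4_hom by (simp add: group_hom_def group_hom_axioms_def)
  show ?thesis
  proof (rule that)
    show "group (A4 R Mod group_center (U4 R))"
      unfolding group_center_U4 by (rule normal.factorgroup_is_group[OF normal_kernel])
    show "(\<lambda>X. the_elem (to_quo4 ` X)) \<in> iso (A4 R Mod group_center (U4 R)) (quo4 R)"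
      unfolding group_center_U4
      by (rule FactGroup_iso_set) (use to_quo4_surj in \<open>simp add: A4_def\<close>)
  qed
qed

subsection \<open>Automorphisms of the quotient group\<close>

text \<open>The unipotent radical \<open>U\<close> is the set of elements of exponent 4. The involutions of \<open>U\<close> lie in
  the root subgroup \<open>M = {a = c = 0}\<close> or in \<open>N = {b = 0}\<close>, which are the centralizers of their
  noncentral elements. Only \<open>M\<close> is centralized modulo the centre of \<open>U\<close> by some element outside \<open>U\<close>,
  hence every automorphism preserves \<open>M\<close>.\<close>

lemma quo4_automorphism_semilinear:
  assumes char2: "(2::'a) = 0"
    and phi: "\<phi> \<in> iso (quo4 R) (quo4 R)"
    and w: "w \<in> ring_units R" "w \<noteq> 1"
  obtains F where
    "\<And>r s. r \<in> R \<Longrightarrow> s \<in> R \<Longrightarrow> F (r + s) = F r + F s"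
    "\<And>r. r \<in> R \<Longrightarrow> F r = 0 \<Longrightarrow> r = 0"
    "\<And>x r. x \<in> carrier (quo4 R) \<Longrightarrow> r \<in> R \<Longrightarrow> F (root_ratio x * r) = root_ratio (\<phi> x) * F r"
proof -
  define C where "C = carrier (quo4 R)"
  have mem_C: "(u, v, a, b, c, d, e) \<in> C \<longleftrightarrow> u \<in> ring_units R \<and> v \<in> ring_units R \<and>
      a \<in> R \<and> b \<in> R \<and> c \<in> R \<and> d \<in> R \<and> e \<in> R" for u v a b c d e
    by (simp add: C_def)
  have C_E: "\<exists>u v a b c d e. x = (u, v, a, b, c, d, e)" for x :: "'a \<times> 'a \<times> 'a \<times> 'a \<times> 'a \<times> 'a \<times> 'a"
    by (metis prod_cases7)
  have dbl: "x + x = 0" for x :: 'a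
    using char2 by (simp add: mult_2[symmetric])
  have add_eq_0: "x + y = 0 \<longleftrightarrow> x = y" for x y :: 'a
    using add_right_cancel[of x y y] dbl[of y] by simp
  have sq_1: "y = 1" if "y * y = 1" for y :: 'a
  proof -
    have "(y + 1) * (y + 1) = y * y + 1 + (y + y)" by (simp add: algebra_simps)
    then have "(y + 1) * (y + 1) = 0" using that dbl char2 by simp
    then show ?thesis using add_eq_0 by simp
  qed
  have hom: "\<phi> \<in> hom (quo4 R) (quo4 R)" and bij: "bij_betw \<phi> C C"
    using phi unfolding iso_def C_def by simp_all
  have phi_C: "\<phi> x \<in> C" if "x \<in> C" for x
    using bij that by (rule bij_betwE[THEN bspec])
  have mult: "\<phi> (quo_mult x y) = quo_mult (\<phi> x) (\<phi> y)" if "x \<in> C" "y \<in> C" for x y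
    using hom_mult[OF hom, of x y] that by (simp add: C_def)
  have inj: "x = y" if "x \<in> C" "y \<in> C" "\<phi> x = \<phi> y" for x y
    using inj_onD[OF bij_betw_imp_inj_on[OF bij] that(3) that(1,2)] .
  have surj: "\<exists>x\<in>C. y = \<phi> x" if "y \<in> C" for y
    using bij_betw_imp_surj_on[OF bij] that by blast
  have closed: "quo_mult x y \<in> C" if "x \<in> C" "y \<in> C" for x y
    using monoid.m_closed[OF group.is_monoid[OF group_quo4], of x y] that by (simp add: C_def)
  have phi_1: "\<phi> (1, 1, 0, 0, 0, 0, 0) = (1, 1, 0, 0, 0, 0, 0)"
    using hom_one[OF hom group_quo4 group_quo4] by simp
  define U where "U = {(1::'a, 1::'a, a, b, c, d, e) | a b c d e.
    a \<in> R \<and> b \<in> R \<and> c \<in> R \<and> d \<in> R \<and> e \<in> R}"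
  define Z where "Z = {(1::'a, 1::'a, 0::'a, 0::'a, 0::'a, d, e) | d e. d \<in> R \<and> e \<in> R}"
  have UC: "x \<in> C" if "x \<in> U" for x
    using that by (auto simp: U_def mem_C R_closed)
  have ZU: "x \<in> U" if "x \<in> Z" for x
    using that by (auto simp: U_def Z_def R_closed)
  \<comment> \<open>The fourth power of \<open>x\<close> has diagonal entries \<open>u^4\<close> and
    \<open>v^4\<close>, and in characteristic 2 only 1 squares to 1. Conversely
    \<open>(1 + n)^4 = 1 + n^4 = 1\<close> for strictly upper triangular \<open>n\<close>.\<close>
  have U_iff: "x \<in> U \<longleftrightarrow> quo_mult (quo_mult x x) (quo_mult x x) = (1, 1, 0, 0, 0, 0, 0)"
    if "x \<in> C" for x
    using that C_E[of x] by (auto simp: U_def mem_C quo_mult_simps dbl dest!: sq_1)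
  have phi_U: "\<phi> x \<in> U \<longleftrightarrow> x \<in> U" if "x \<in> C" for x
  proof -
    let ?y = "quo_mult (quo_mult x x) (quo_mult x x)"
    have "?y \<in> C" "(1, 1, 0, 0, 0, 0, 0) \<in> C" using that closed by (auto simp: mem_C R_closed)
    then have "\<phi> ?y = (1, 1, 0, 0, 0, 0, 0) \<longleftrightarrow> ?y = (1, 1, 0, 0, 0, 0, 0)"
      using phi_1 inj by metis
    moreover have "\<phi> ?y = quo_mult (quo_mult (\<phi> x) (\<phi> x)) (quo_mult (\<phi> x) (\<phi> x))"
      using mult closed that by metis
    ultimately show ?thesis using U_iff[OF that] U_iff[OF phi_C[OF that]] by simp
  qed
  have Z_iff: "x \<in> Z \<longleftrightarrow> x \<in> U \<and> (\<forall>y\<in>U. quo_mult x y = quo_mult y x)" for x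
  proof (intro iffI conjI ballI)
    fix y assume "x \<in> Z" "y \<in> U"
    then show "quo_mult x y = quo_mult y x"
      by (auto simp: Z_def U_def quo_mult_simps add.commute)
  next
    assume x: "x \<in> U \<and> (\<forall>y\<in>U. quo_mult x y = quo_mult y x)"
    then obtain a b c d e where eq: "x = (1, 1, a, b, c, d, e)" and R: "d \<in> R" "e \<in> R"
      by (auto simp: U_def)
    have "(1, 1, 1, 0, 0, 0, 0) \<in> U" "(1, 1, 0, 1, 0, 0, 0) \<in> U"
      by (auto simp: U_def R_closed)
    then have "quo_mult x (1, 1, 1, 0, 0, 0, 0) = quo_mult (1, 1, 1, 0, 0, 0, 0) x"
      "quo_mult x (1, 1, 0, 1, 0, 0, 0) = quo_mult (1, 1, 0, 1, 0, 0, 0) x" using x by blast+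
    then show "x \<in> Z" using R by (auto simp: eq quo_mult_simps Z_def)
  qed (use ZU in blast)
  have phi_Z: "\<phi> x \<in> Z \<longleftrightarrow> x \<in> Z" if x: "x \<in> C" for x
  proof -
    have "(\<forall>y\<in>U. quo_mult (\<phi> x) y = quo_mult y (\<phi> x)) \<longleftrightarrow>
          (\<forall>y\<in>U. quo_mult (\<phi> x) (\<phi> y) = quo_mult (\<phi> y) (\<phi> x))"
      using phi_U surj UC by metis
    also have "\<dots> \<longleftrightarrow> (\<forall>y\<in>U. quo_mult x y = quo_mult y x)"
      using mult[OF x UC] mult[OF UC x] inj[OF closed[OF x UC] closed[OF UC x]] by metis
    finally show ?thesis using phi_U[OF x] Z_iff by blast
  qed
  define M where "M = {(1::'a, 1::'a, 0::'a, b, 0::'a, d, e) | b d e. b \<in> R \<and> d \<in> R \<and> e \<in> R}"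
  have MU: "x \<in> U" if "x \<in> M" for x
    using that by (auto simp: U_def M_def R_closed)
  \<comment> \<open>\<open>M\<close> is the centralizer of \<open>g = e_{2,3}(1)\<close> in
    \<open>U\<close>, so its image is the centralizer of \<open>\<phi> g\<close>, and it suffices to
    locate this one element.\<close>
  define g where "g = (1::'a, 1::'a, 0::'a, 1::'a, 0::'a, 0::'a, 0::'a)"
  have gM: "g \<in> M" by (auto simp: g_def M_def R_closed)
  have gC: "g \<in> C" using UC MU gM by blast
  have M_iff: "x \<in> M \<longleftrightarrow> x \<in> U \<and> quo_mult g x = quo_mult x g" for x
    by (auto simp: M_def U_def g_def quo_mult_simps R_closed)
  obtain ga gb gc gd ge where pg: "\<phi> g = (1, 1, ga, gb, gc, gd, ge)"
    using phi_U[OF gC] MU[OF gM] by (auto simp: U_def)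
  have "quo_mult g g = (1, 1, 0, 0, 0, 0, 0)"
    using char2 by (simp add: g_def quo_mult_simps)
  then have "quo_mult (\<phi> g) (\<phi> g) = (1, 1, 0, 0, 0, 0, 0)"
    using mult[OF gC gC] phi_1 by simp
  \<comment> \<open>These products are the last two coordinates of the square of
    \<open>\<phi> g\<close>, the doubled terms vanishing.\<close>
  then have gab: "ga * gb = 0" "gb * gc = 0"
    by (auto simp: pg quo_mult_simps add_eq_0 char2)
  have gb: "gb \<noteq> 0"
  proof
    assume gb0: "gb = 0"
    \<comment> \<open>The matrix \<open>diag(1, w, w, 1)\<close> has ratio 1 and so commutes with
      \<open>M\<close> modulo \<open>Z\<close>, yet lies outside \<open>U\<close>. If
      \<open>gb = 0\<close>, then \<open>e_{1,2}(1)\<close> and \<open>e_{3,4}(1)\<close> centralize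
      \<open>\<phi> g\<close>, so \<open>\<phi> x\<close> commutes with both modulo
      \<open>Z\<close>; this forces its diagonal to be trivial and puts \<open>x\<close> in
      \<open>U\<close>.\<close>
    define x where "x = (w, w, 0::'a, 0::'a, 0::'a, 0::'a, 0::'a)"
    have xC: "x \<in> C" using w by (simp add: x_def mem_C R_closed)
    have xZ: "\<exists>z\<in>Z. quo_mult x m = quo_mult (quo_mult z m) x" if mM: "m \<in> M" for m
    proof -
      obtain b d e where m: "m = (1, 1, 0, b, 0, d, e)" "b \<in> R" "d \<in> R" "e \<in> R"
        using mM by (auto simp: M_def)
      have "(1, 1, 0, 0, 0, d * inverse w - d, w * e - e) \<in> Z"
        using m w by (auto simp: Z_def R_closed)
      moreover have "quo_mult x m = quo_mult (quo_mult (1, 1, 0, 0, 0, d * inverse w - d, w * e - e) m) x"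
        using ring_units_nz[OF w(1)] by (simp add: m x_def quo_mult_simps)
      ultimately show ?thesis by blast
    qed
    have act: "\<exists>z\<in>Z. quo_mult (\<phi> x) y = quo_mult (quo_mult z y) (\<phi> x)"
      if y: "y \<in> U" "quo_mult (\<phi> g) y = quo_mult y (\<phi> g)" for y
    proof -
      obtain m where m: "m \<in> C" "y = \<phi> m" using surj[OF UC[OF y(1)]] by blast
      have "m \<in> U" using phi_U[OF m(1)] y(1) m(2) by simp
      moreover have "quo_mult g m = quo_mult m g"
        using y(2) inj[OF closed[OF gC m(1)] closed[OF m(1) gC]] mult gC m by simp
      ultimately have "m \<in> M" using M_iff by blast
      then obtain z where z: "z \<in> Z" "quo_mult x m = quo_mult (quo_mult z m) x" using xZ by blast
      have zC: "z \<in> C" using z(1) ZU UC by blast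
      have "quo_mult (\<phi> x) y = quo_mult (quo_mult (\<phi> z) y) (\<phi> x)"
        using arg_cong[OF z(2), of \<phi>] mult m xC zC closed by simp
      moreover have "\<phi> z \<in> Z" using phi_Z zC z(1) by simp
      ultimately show ?thesis by blast
    qed
    obtain u v a b c d e where px: "\<phi> x = (u, v, a, b, c, d, e)" using C_E by blast
    have "(1, 1, 1, 0, 0, 0, 0) \<in> U" "(1, 1, 0, 0, 1, 0, 0) \<in> U"
      by (auto simp: U_def R_closed)
    from this[THEN act] have "u = 1 \<and> v = 1"
      by (auto simp: pg gb0 px Z_def quo_mult_simps add.commute)
    then have "\<phi> x \<in> U" using phi_C[OF xC] by (auto simp: px U_def mem_C)
    then have "x \<in> U" using phi_U[OF xC] by simp
    then show False using w by (auto simp: x_def U_def)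
  qed
  then have gac: "ga = 0" "gc = 0" using gab by auto
  \<comment> \<open>With \<open>ga = gc = 0\<close> and \<open>gb \<noteq> 0\<close>, the
    centralizer of \<open>\<phi> g\<close> in \<open>U\<close> is again \<open>M\<close>.\<close>
  have phi_M: "\<phi> m \<in> M" if "m \<in> M" for m
  proof -
    have m: "m \<in> U" "quo_mult g m = quo_mult m g" using that M_iff by auto
    have "quo_mult (\<phi> g) (\<phi> m) = quo_mult (\<phi> m) (\<phi> g)"
      using mult[OF gC UC[OF m(1)]] mult[OF UC[OF m(1)] gC] m(2) by simp
    moreover have "\<phi> m \<in> U" using phi_U[OF UC] m by blast
    ultimately show ?thesis using gb
      by (auto simp: U_def M_def pg gac quo_mult_simps)
  qed
  define e23 where "e23 r = (1::'a, 1::'a, 0::'a, r, 0::'a, 0::'a, 0::'a)" for r :: 'a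
  define pr where "pr = (\<lambda>(u::'a, v::'a, a::'a, b::'a, y::'a \<times> 'a \<times> 'a). b)"
  \<comment> \<open>\<open>F\<close> is the map that \<open>\<phi>\<close> induces on
    \<open>M / Z\<close>, identified with \<open>R\<close> through the (2,3)-entry.\<close>
  define F where "F r = pr (\<phi> (e23 r))" for r
  have eM: "e23 r \<in> M" if "r \<in> R" for r
    using that by (auto simp: M_def e23_def R_closed)
  have eC: "e23 r \<in> C" if "r \<in> R" for r
    using that by (auto simp: e23_def mem_C R_closed)
  have F: "\<exists>d e. d \<in> R \<and> e \<in> R \<and> \<phi> (e23 r) = (1, 1, 0, F r, 0, d, e)" if "r \<in> R" for r
    using phi_M[OF eM[OF that]] by (auto simp: M_def F_def pr_def)
  show ?thesis
  proof (rule that)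
    fix r s assume rs: "r \<in> R" "s \<in> R"
    have "e23 (r + s) = quo_mult (e23 r) (e23 s)"
      by (simp add: e23_def quo_mult_simps)
    then have "\<phi> (e23 (r + s)) = quo_mult (\<phi> (e23 r)) (\<phi> (e23 s))"
      using mult eC rs by simp
    then show "F (r + s) = F r + F s"
      using F[OF rs(1)] F[OF rs(2)] F[OF add_R[OF rs]] by (auto simp: quo_mult_simps add.commute)
  next
    fix r assume r: "r \<in> R" "F r = 0"
    then have "\<phi> (e23 r) \<in> Z" using F[OF r(1)] by (auto simp: Z_def)
    then have "e23 r \<in> Z" using phi_Z eC r by blast
    then show "r = 0" by (auto simp: Z_def e23_def)
  next
    fix x r assume "x \<in> carrier (quo4 R)" and r: "r \<in> R"
    then have xC: "x \<in> C" by (simp add: C_def)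
    then obtain u v a b c d e where x: "x = (u, v, a, b, c, d, e)"
      and R: "u \<in> ring_units R" "v \<in> ring_units R" "a \<in> R" "c \<in> R" using C_E[of x] by (auto simp: mem_C)
    define q where "q = root_ratio x * r"
    have q: "q = u * inverse v * r" by (simp add: q_def x root_ratio_simps field_simps)
    have qR: "q \<in> R" using R r by (simp add: q R_closed)
    \<comment> \<open>Conjugation by \<open>x\<close> takes \<open>e23 r\<close> to
      \<open>e23 q\<close> up to this element of \<open>Z\<close>, which absorbs the contributions
      of \<open>a\<close> and \<open>c\<close>. Since \<open>\<phi> z\<close> is in
      \<open>Z\<close>, it does not affect the (2,3)-entries compared below.\<close>
    define z where "z = (1::'a, 1::'a, 0::'a, 0::'a, 0::'a, a * r * inverse v, - q * c)"
    have zZ: "z \<in> Z" using R r qR by (auto simp: z_def Z_def R_closed)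
    have zC: "z \<in> C" using zZ ZU UC by blast
    have "quo_mult x (e23 r) = quo_mult (quo_mult (e23 q) z) x"
      using ring_units_nz[OF R(2)] by (simp add: x e23_def z_def q quo_mult_simps)
    then have "\<phi> (quo_mult x (e23 r)) = \<phi> (quo_mult (quo_mult (e23 q) z) x)" by simp
    then have eq: "quo_mult (\<phi> x) (\<phi> (e23 r)) = quo_mult (quo_mult (\<phi> (e23 q)) (\<phi> z)) (\<phi> x)"
      using mult xC eC[OF r] eC[OF qR] zC closed by simp
    obtain u' v' a' b' c' d' e' where px: "\<phi> x = (u', v', a', b', c', d', e')"
      using C_E by blast
    have v': "v' \<noteq> 0" using phi_C[OF xC] ring_units_nz by (auto simp: px mem_C)
    have "\<phi> z \<in> Z" using phi_Z zC zZ by simp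
    then have "u' * F r = F q * v'"
      using eq F[OF r] F[OF qR] by (auto simp: px Z_def quo_mult_simps)
    then have "F q = root_ratio (\<phi> x) * F r"
      using v' by (simp add: px root_ratio_simps field_simps)
    then show "F (root_ratio x * r) = root_ratio (\<phi> x) * F r"
      by (simp only: q_def)
  qed
qed

end

subsection \<open>Rigidity of the coefficient ring\<close>

lemma to_fract_power: "to_fract (x ^ n) = to_fract x ^ n"
  by (induction n) auto

lemma to_fract_sum: "to_fract (sum g A) = (\<Sum>x\<in>A. to_fract (g x))"
  by (induction A rule: infinite_finite_induct) auto

text \<open>Each factor \<open>p\<close> on the right divides \<open>g\<close> or \<open>h\<close>
  and is cancelled there, one per induction step.\<close>

lemma prime_elem_power_split:
  fixes p g h c :: "'a::idom"
  assumes "prime_elem p" "g * h = p ^ n * c"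
  shows "\<exists>i g' j h'. g = p ^ i * g' \<and> h = p ^ j * h' \<and> g' * h' = c"
  using assms(2)
proof (induction n arbitrary: g h)
  case 0
  then show ?case by (intro exI[of _ 0] exI[of _ g] exI[of _ h]) auto
next
  case (Suc n)
  have p: "p \<noteq> 0" using assms(1) by auto
  have "p dvd g * h" using Suc.prems by simp
  then consider "p dvd g" | "p dvd h" using assms(1) by (auto simp: prime_elem_dvd_mult_iff)
  then show ?case
  proof cases
    case 1
    then obtain k where k: "g = p * k" by auto
    then have "k * h = p ^ n * c" using Suc.prems p by (simp add: mult.assoc)
    from Suc.IH[OF this] obtain i g' j h' where "k = p ^ i * g'" "h = p ^ j * h'" "g' * h' = c"
      by blast
    then show ?thesis using k
      by (intro exI[of _ "Suc i"] exI[of _ g'] exI[of _ j] exI[of _ h']) (auto simp: mult.assoc)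
  next
    case 2
    then obtain k where k: "h = p * k" by auto
    then have "g * k = p ^ n * c" using Suc.prems p by (simp add: ac_simps)
    from Suc.IH[OF this] obtain i g' j h' where "g = p ^ i * g'" "k = p ^ j * h'" "g' * h' = c"
      by blast
    then show ?thesis using k
      by (intro exI[of _ i] exI[of _ g'] exI[of _ "Suc j"] exI[of _ h']) (auto simp: mult.assoc)
  qed
qed

lemma is_unit_bit_poly_iff: "is_unit (g :: bit poly) \<longleftrightarrow> g = 1"
proof
  assume "is_unit g"
  then obtain c where "g = [:c:]" "c \<noteq> 0" by (auto simp: is_unit_poly_iff)
  then show "g = 1" by (auto simp: one_pCons)
qed simp

text \<open>Here \<open>a\<close> and \<open>b\<close> only bound the degrees, so the coefficients
  may be zero. Taking the coefficient at a formal degree is evaluation at infinity, and is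
  multiplicative like evaluation at a point.\<close>

lemma coeff_mult_top:
  assumes "degree p \<le> a" "degree q \<le> b"
  shows "coeff (p * q) (a + b) = coeff p a * coeff q b"
proof -
  have "coeff (p * q) (a + b) = (\<Sum>i\<le>a + b. coeff p i * coeff q (a + b - i))"
    by (rule coeff_mult)
  also have "\<dots> = (\<Sum>i\<in>{a}. coeff p i * coeff q (a + b - i))"
  proof (rule sum.mono_neutral_right)
    show "\<forall>i\<in>{..a + b} - {a}. coeff p i * coeff q (a + b - i) = 0"
    proof
      fix i assume "i \<in> {..a + b} - {a}"
      then have "i > a \<or> a + b - i > b" by auto
      then show "coeff p i * coeff q (a + b - i) = 0"
        using assms by (auto simp: coeff_eq_0)
    qed
  qed auto
  finally show ?thesis by simp
qed

lemma coeff_power_top: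
  assumes "degree p \<le> m"
  shows "coeff (p ^ k) (k * m) = coeff p m ^ k \<and> degree (p ^ k) \<le> k * m"
proof (induction k)
  case (Suc k)
  have "degree (p * p ^ k) \<le> m + k * m"
    using degree_mult_le[of p "p ^ k"] assms Suc by linarith
  then show ?case using Suc coeff_mult_top[OF assms, of "p ^ k" "k * m"] by simp
qed simp

section \<open>The polynomial \<open>f\<close> and its values over the field with two
  elements\<close>

locale non_self_reciprocal =
  fixes f :: "bit poly"
  assumes irreducible_f: "irreducible f"
    and f_not_X: "f \<noteq> [:0, 1:]"
    and not_self_reciprocal_f: "\<not> self_reciprocal f"
begin

abbreviation X :: "bit poly" where "X \<equiv> [:0, 1:]"
abbreviation t :: "bit poly fract" where "t \<equiv> to_fract X"
abbreviation ft :: "bit poly fract" where "ft \<equiv> to_fract f"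

text \<open>All nonzero coefficients being 1, \<open>f(s)\<close> is the plain sum of
  \<open>s^k\<close> over this set.\<close>

definition supp :: "nat set" where "supp = {k. coeff f k = 1}"

lemma prime_X: "prime_elem X"
  by (rule prime_elem_linear_field_poly) simp

lemma prime_f: "prime_elem f"
  by (rule field_poly_irreducible_imp_prime[OF irreducible_f])

lemma f_nz: "f \<noteq> 0"
  using prime_f by auto

lemma t_nz: "t \<noteq> 0" and ft_nz: "ft \<noteq> 0"
  using f_nz by auto

lemma not_unit_f: "\<not> is_unit f"
  using irreducible_f by (rule irreducible_not_unit)

lemma nonunit_dvd_f:
  assumes "\<not> is_unit p" "p dvd f"
  shows "f = p"
proof -
  obtain q where q: "f = p * q" using assms(2) by auto
  then have "is_unit q" using irreducibleD[OF irreducible_f q] assms(1) by auto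
  then show ?thesis using q by (simp add: is_unit_bit_poly_iff)
qed

lemma degree_f: "degree f > 0"
  using not_unit_f f_nz by (auto simp: is_unit_poly_iff elim!: degree_eq_zeroE intro!: Nat.gr0I)

lemma poly_f_0: "poly f 0 = 1"
proof (rule ccontr)
  assume "poly f 0 \<noteq> 1"
  then have "X dvd f" using poly_eq_0_iff_dvd[of f 0] by simp
  moreover have "\<not> is_unit X" using prime_X by (simp add: prime_elem_def)
  ultimately show False using nonunit_dvd_f f_not_X by blast
qed

text \<open>A root at 1 would make the irreducible \<open>f\<close> equal to \<open>t + 1\<close>,
  which is self-reciprocal.\<close>

lemma poly_f_1: "poly f 1 = 1"
proof (rule ccontr)
  assume "poly f 1 \<noteq> 1"
  then have "[:1, 1:] dvd f" using poly_eq_0_iff_dvd[of f 1] by simp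
  moreover have "\<not> is_unit ([:1, 1:] :: bit poly)" unfolding is_unit_bit_poly_iff by (simp add: one_pCons)
  ultimately have "f = [:1, 1:]" using nonunit_dvd_f by blast
  then have "self_reciprocal f"
    by (simp add: self_reciprocal_def monom_Suc one_pCons monom_0)
  then show False using not_self_reciprocal_f by simp
qed

lemma finite_supp: "finite supp" and supp_le: "k \<in> supp \<Longrightarrow> k \<le> degree f"
proof -
  show le: "k \<le> degree f" if "k \<in> supp" for k
    using that by (intro le_degree) (auto simp: supp_def)
  show "finite supp" by (rule finite_subset[of _ "{..degree f}"]) (use le in auto)
qed

lemma zero_in_supp: "0 \<in> supp"
  using poly_f_0 by (simp add: supp_def poly_0_coeff_0)

lemma degree_in_supp: "degree f \<in> supp"
  using leading_coeff_neq_0[OF f_nz] by (simp add: supp_def del: leading_coeff_neq_0 leading_coeff_0_iff)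

lemma sum_supp: "(\<Sum>k\<in>supp. g k) = (\<Sum>k\<le>degree f. if coeff f k = 1 then g k else (0::'b::comm_monoid_add))"
  by (rule sum.mono_neutral_cong_left) (auto simp: supp_def intro: le_degree)

lemma f_eq_sum: "f = (\<Sum>k\<in>supp. X ^ k)"
proof -
  have "f = (\<Sum>k\<le>degree f. monom (coeff f k) k)"
    by (rule poly_as_sum_of_monoms[symmetric])
  also have "\<dots> = (\<Sum>k\<in>supp. X ^ k)"
    unfolding sum_supp by (intro sum.cong refl) (auto simp: monom_altdef)
  finally show ?thesis .
qed

lemma sum_supp_1: "(\<Sum>k\<in>supp. 1) = (1::bit)"
  using arg_cong[OF f_eq_sum, of "\<lambda>p. poly p 1"] poly_f_1 by (simp add: poly_sum)

text \<open>The homogenization of \<open>f\<close> has no zero on the projective line over the field with two elements.\<close>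

lemma homogenization_bit:
  fixes x y :: bit
  assumes "x \<noteq> 0 \<or> y \<noteq> 0"
  shows "(\<Sum>k\<in>supp. x ^ k * y ^ (degree f - k)) = 1"
proof -
  \<comment> \<open>Only the constant term survives at \<open>(0, 1)\<close>, only the leading term
    at \<open>(1, 0)\<close>, and the value at \<open>(1, 1)\<close> is \<open>f(1)\<close>.\<close>
  have "(\<Sum>k\<in>supp. x ^ k * y ^ (degree f - k)) = (\<Sum>k\<in>supp. if k = 0 then 1 else 0)" if "x = 0" "y = 1"
    using that by (intro sum.cong) auto
  moreover have "(\<Sum>k\<in>supp. x ^ k * y ^ (degree f - k)) = (\<Sum>k\<in>supp. if k = degree f then 1 else 0)"
    if "x = 1" "y = 0"
    using that supp_le by (intro sum.cong) (auto simp: power_0_left dest: order_antisym)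
  ultimately show ?thesis
    using assms sum_supp_1 zero_in_supp degree_in_supp finite_supp
    by (cases x; cases y) (auto simp: sum.delta)
qed

section \<open>Units \<open>t^i f^j\<close> in lowest terms, and the values of \<open>f\<close> at
  them\<close>

lemma X_not_dvd_f_power: "\<not> X dvd f ^ k" and f_not_dvd_X_power: "\<not> f dvd X ^ k"
proof -
  have "\<not> X dvd f"
    using poly_f_0 by (auto elim!: dvdE)
  then show "\<not> X dvd f ^ k" using prime_elem_dvd_power[OF prime_X] by blast
  have "\<not> f dvd X"
  proof
    assume "f dvd X"
    then obtain q where q: "X = f * q" by auto
    have "irreducible X" using prime_X by (rule prime_elem_imp_irreducible)
    then have "is_unit q" using irreducibleD[of X f q] q not_unit_f by auto
    then show False using q f_not_X by (simp add: is_unit_bit_poly_iff)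
  qed
  then show "\<not> f dvd X ^ k" using prime_elem_dvd_power[OF prime_f] by blast
qed

text \<open>Splitting off first the powers of \<open>X\<close>, then those of \<open>f\<close>,
  leaves a unit, and 1 is the only unit polynomial.\<close>

lemma divisor_of_monomial:
  assumes "g * h = X ^ a * f ^ b"
  obtains i j where "g = X ^ i * f ^ j"
proof -
  obtain i g' j h' where 1: "g = X ^ i * g'" "h = X ^ j * h'" "g' * h' = f ^ b * 1"
    using prime_elem_power_split[OF prime_X assms] by auto
  obtain k g'' l h'' where 2: "g' = f ^ k * g''" "h' = f ^ l * h''" "g'' * h'' = 1"
    using prime_elem_power_split[OF prime_f 1(3)] by blast
  have "g'' = 1" using 2(3) is_unit_bit_poly_iff[of g''] by (metis dvd_triv_left)
  then show ?thesis using that[of i k] 1 2 by simp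
qed

lemma coprime_monomials_eq:
  assumes "X ^ a * f ^ b = X ^ c * f ^ d" "a = 0 \<or> c = 0" "b = 0 \<or> d = 0"
  shows "a = 0 \<and> b = 0 \<and> c = 0 \<and> d = 0"
proof -
  have X0: "a = 0" if "X ^ a * f ^ b = X ^ c * f ^ d" "c = 0" for a b c d
  proof (rule ccontr)
    assume "a \<noteq> 0"
    then have "X dvd X ^ a * f ^ b" by (simp add: dvd_power)
    then show False using that X_not_dvd_f_power by simp
  qed
  have f0: "b = 0" if "X ^ a * f ^ b = X ^ c * f ^ d" "d = 0" for a b c d
  proof (rule ccontr)
    assume "b \<noteq> 0"
    then have "f dvd X ^ a * f ^ b" by (simp add: dvd_power)
    then show False using that f_not_dvd_X_power by simp
  qed
  show ?thesis using X0[OF assms(1)] X0[OF assms(1)[symmetric]] f0[OF assms(1)] f0[OF assms(1)[symmetric]]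
      assms(2,3) by auto
qed

lemma powi_nat_split: "(y::'b::field) \<noteq> 0 \<Longrightarrow> y powi i = y ^ nat i / y ^ nat (- i)"
  by (cases "i \<ge> 0") (auto simp: power_int_def field_simps)

text \<open>The numerator of \<open>t^i f^j\<close> in lowest terms, because \<open>nat\<close>
  sends negative exponents to 0; \<open>num (- i) (- j)\<close> is the denominator.\<close>

definition num :: "int \<Rightarrow> int \<Rightarrow> bit poly" where
  "num i j = X ^ nat i * f ^ nat j"

lemma num_nz: "num i j \<noteq> 0"
  using f_nz by (simp add: num_def)

lemma unit_eq_quotient: "t powi i * ft powi j = to_fract (num i j) / to_fract (num (- i) (- j))"
  using powi_nat_split[OF t_nz, of i] powi_nat_split[OF ft_nz, of j]
  by (simp add: num_def to_fract_power)

lemma unit_eq_1_iff: "t powi i * ft powi j = 1 \<longleftrightarrow> i = 0 \<and> j = 0"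
proof
  assume "t powi i * ft powi j = 1"
  then have "to_fract (num i j) = to_fract (num (- i) (- j))"
    using num_nz unfolding unit_eq_quotient by (simp add: field_simps)
  then have "num i j = num (- i) (- j)" by simp
  then have "X ^ nat i * f ^ nat j = X ^ nat (- i) * f ^ nat (- j)" by (simp add: num_def)
  from coprime_monomials_eq[OF this] show "i = 0 \<and> j = 0" by linarith
qed simp

text \<open>The homogenization of \<open>f\<close> at the numerator and denominator of
  \<open>s = t^i f^j\<close>, that is, the numerator of \<open>f(s)\<close>.\<close>

definition homog :: "int \<Rightarrow> int \<Rightarrow> bit poly" where
  "homog i j = (\<Sum>k\<in>supp. num i j ^ k * num (- i) (- j) ^ (degree f - k))"

lemma sum_powers_unit:
  "(\<Sum>k\<in>supp. (t powi i * ft powi j) ^ k) = to_fract (homog i j) / to_fract (num (- i) (- j)) ^ degree f"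
proof -
  let ?A = "to_fract (num i j)" and ?B = "to_fract (num (- i) (- j))"
  have "(?A / ?B) ^ k = ?A ^ k * ?B ^ (degree f - k) / ?B ^ degree f" if "k \<in> supp" for k
    using power_add[of ?B k "degree f - k"] supp_le[OF that] num_nz by (simp add: field_simps)
  then show ?thesis
    by (simp add: unit_eq_quotient homog_def to_fract_sum to_fract_power sum_divide_distrib)
qed

lemma poly_num_0: "poly (num i j) 0 = 0 ^ nat i"
  using poly_f_0 by (simp add: num_def poly_power)

text \<open>Numerator and denominator do not both vanish at 0, so \<open>homogenization_bit\<close>
  applies: \<open>f(s)\<close> acquires no zero at the place 0.\<close>

lemma poly_homog_0: "poly (homog i j) 0 = 1"
  unfolding homog_def poly_sum poly_mult poly_power
  by (rule homogenization_bit) (simp add: poly_num_0 linorder_linear)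

text \<open>The same argument at infinity: numerator and denominator, taken at the common formal
  degree \<open>m\<close>, do not both have top coefficient 0.\<close>

lemma coeff_homog:
  assumes "m = max (degree (num i j)) (degree (num (- i) (- j)))"
  shows "coeff (homog i j) (degree f * m) = 1"
proof -
  let ?A = "num i j" and ?B = "num (- i) (- j)"
  have deg: "degree ?A \<le> m" "degree ?B \<le> m" using assms by auto
  have "coeff (?A ^ k * ?B ^ (degree f - k)) (degree f * m) = coeff ?A m ^ k * coeff ?B m ^ (degree f - k)"
    if "k \<in> supp" for k
  proof -
    have "degree f * m = k * m + (degree f - k) * m"
      using supp_le[OF that] by (simp add: add_mult_distrib[symmetric])
    then show ?thesis
      using coeff_mult_top[of "?A ^ k" "k * m" "?B ^ (degree f - k)" "(degree f - k) * m"]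
        coeff_power_top[OF deg(1), of k] coeff_power_top[OF deg(2), of "degree f - k"] by simp
  qed
  then have "coeff (homog i j) (degree f * m) = (\<Sum>k\<in>supp. coeff ?A m ^ k * coeff ?B m ^ (degree f - k))"
    by (simp add: homog_def coeff_sum)
  also have "\<dots> = 1"
  proof (rule homogenization_bit)
    have "m = degree ?A \<or> m = degree ?B" using assms by (auto simp: max_def)
    then show "coeff ?A m \<noteq> 0 \<or> coeff ?B m \<noteq> 0"
      using leading_coeff_neq_0[OF num_nz[of i j]] leading_coeff_neq_0[OF num_nz[of "- i" "- j"]] by metis
  qed
  finally show ?thesis .
qed

text \<open>The same at the place \<open>f\<close>: exactly one of numerator and denominator is
  divisible by \<open>f\<close>, hence so are all terms except the one at an end of the sum, a pure
  power of the other.\<close>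

lemma not_dvd_homog:
  assumes "j \<noteq> 0"
  shows "\<not> f dvd homog i j"
proof
  assume dvd: "f dvd homog i j"
  let ?A = "num i j" and ?B = "num (- i) (- j)" and ?n = "degree f"
  let ?h = "\<lambda>k. ?A ^ k * ?B ^ (?n - k)"
  have num_dvd: "f dvd num i j \<longleftrightarrow> j > 0" for i j
  proof
    assume "f dvd num i j"
    then have "f dvd f ^ nat j" using f_not_dvd_X_power prime_f by (auto simp: num_def prime_elem_dvd_mult_iff)
    then show "j > 0" using not_unit_f by (cases "j > 0") auto
  qed (auto simp: num_def intro!: dvd_mult dvd_power)
  have split: "homog i j = ?h l + (\<Sum>k\<in>supp - {l}. ?h k)" if "l \<in> supp" for l
    unfolding homog_def using finite_supp that by (rule sum.remove)
  show False
  proof (cases "j > 0")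
    case True
    have "f dvd ?h k" if "k \<in> supp - {0}" for k
    proof -
      have "?A dvd ?A ^ k" using that by (simp add: dvd_power)
      then show ?thesis using num_dvd[of i j] True by (meson dvd_mult2 dvd_trans)
    qed
    then have rest: "f dvd (\<Sum>k\<in>supp - {0}. ?h k)" by (rule dvd_sum)
    have "f dvd ?h 0"
      using dvd unfolding split[OF zero_in_supp] dvd_add_left_iff[OF rest] .
    then have "f dvd ?B" using prime_elem_dvd_power[OF prime_f] by simp
    then show False using num_dvd[of "- i" "- j"] True by simp
  next
    case False
    then have j: "- j > 0" using assms by simp
    have "f dvd ?h k" if "k \<in> supp - {?n}" for k
    proof -
      have "?n - k > 0" using supp_le[of k] that by auto
      then have "?B dvd ?B ^ (?n - k)" by (simp add: dvd_power)
      then show ?thesis using num_dvd[of "- i" "- j"] j by (meson dvd_mult dvd_trans)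
    qed
    then have rest: "f dvd (\<Sum>k\<in>supp - {?n}. ?h k)" by (rule dvd_sum)
    have "f dvd ?h ?n"
      using dvd unfolding split[OF degree_in_supp] dvd_add_left_iff[OF rest] .
    then have "f dvd ?A" using prime_elem_dvd_power[OF prime_f] by simp
    then show False using num_dvd[of i j] False by simp
  qed
qed

text \<open>When \<open>f(s)\<close> is a unit, \<open>homog i j\<close> divides a monomial in
  \<open>X\<close> and \<open>f\<close>, and its value 1 at 0 excludes the factor
  \<open>X\<close>.\<close>

lemma homog_eq_power:
  assumes "(\<Sum>k\<in>supp. (t powi i * ft powi j) ^ k) = t powi a * ft powi b"
  obtains l where "homog i j = f ^ l"
proof -
  have "to_fract (homog i j) / to_fract (num (- i) (- j)) ^ degree f = to_fract (num a b) / to_fract (num (- a) (- b))"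
    using assms unfolding sum_powers_unit by (simp only: unit_eq_quotient)
  then have "to_fract (homog i j * num (- a) (- b)) = to_fract (num a b * num (- i) (- j) ^ degree f)"
    using num_nz by (simp add: field_simps to_fract_power)
  then have "homog i j * num (- a) (- b) = num a b * num (- i) (- j) ^ degree f"
    by (simp only: to_fract_eq_iff)
  also have "\<dots> = X ^ (nat a + nat (- i) * degree f) * f ^ (nat b + nat (- j) * degree f)"
    unfolding num_def power_mult_distrib power_add power_mult by (simp only: ac_simps)
  finally obtain k l where kl: "homog i j = X ^ k * f ^ l"
    by (rule divisor_of_monomial)
  have "0 ^ k = (1::bit)"
    using poly_homog_0[of i j] poly_f_0 by (simp add: kl poly_power)
  then have "k = 0" by (cases k) auto
  then show ?thesis using that[of l] kl by simp
qed

text \<open>A nonconstant unit \<open>s = t\<^sup>i f\<^sup>j\<close> has a pole at one of the places \<open>0\<close>, \<open>\<infinity>\<close>, \<open>f\<close>, and \<open>f(s)\<close> has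
  a pole there as well. If \<open>j \<noteq> 0\<close>, then \<open>f(s)\<close> has no zero at any of the three places, so it is not a
  unit.\<close>

lemma exponent_f_eq_0:
  assumes "homog i j = f ^ l"
  shows "j = 0"
proof (rule ccontr)
  assume j: "j \<noteq> 0"
  then have "\<not> f dvd f ^ l" using not_dvd_homog assms by metis
  then have l: "l = 0" by (cases l) auto
  define m where "m = max (degree (num i j)) (degree (num (- i) (- j)))"
  \<comment> \<open>Now \<open>homog i j = 1\<close>, so its coefficient at
    \<open>degree f * m\<close> forces \<open>m = 0\<close>; but \<open>m\<close> bounds both
    \<open>nat j\<close> and \<open>nat (- j)\<close>.\<close>
  have "degree f * m \<le> degree (homog i j)"
    by (rule le_degree) (simp add: coeff_homog[OF m_def])
  then have "m = 0" using degree_f by (simp add: assms l)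
  moreover have deg: "degree (num i j) \<ge> nat j" for i j
    using degree_f f_nz by (simp add: num_def degree_mult_eq degree_power_eq trans_le_add2)
  moreover have "nat j \<le> m" "nat (- j) \<le> m"
    using deg[of j i] deg[of "- j" "- i"] by (auto simp: m_def)
  ultimately show False using j by simp
qed

section \<open>The ring \<open>R_f\<close> and its unit group\<close>

lemma mem_Rf_iff: "x \<in> Rf f \<longleftrightarrow> (\<exists>g a b. x = to_fract g / (t ^ a * ft ^ b))"
  unfolding Rf_def Fract_conv_to_fract by (auto simp: to_fract_power)

lemma Rf_subring: "subring_of_field (Rf f)"
proof
  show "0 \<in> Rf f" unfolding mem_Rf_iff by (intro exI[of _ 0]) simp
  show "1 \<in> Rf f" unfolding mem_Rf_iff by (intro exI[of _ 1] exI[of _ 0]) simp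
next
  fix x y assume "x \<in> Rf f" "y \<in> Rf f"
  then obtain g a b h c d where xy: "x = to_fract g / (t ^ a * ft ^ b)" "y = to_fract h / (t ^ c * ft ^ d)"
    unfolding mem_Rf_iff by blast
  have "x * y = to_fract (g * h) / (t ^ (a + c) * ft ^ (b + d))"
    by (simp add: xy power_add ac_simps)
  then show "x * y \<in> Rf f" unfolding mem_Rf_iff by blast
  have "x + y = to_fract (g * X ^ c * f ^ d + h * X ^ a * f ^ b) / (t ^ (a + c) * ft ^ (b + d))"
    using t_nz ft_nz by (simp add: xy power_add to_fract_power field_simps)
  then show "x + y \<in> Rf f" unfolding mem_Rf_iff by blast
next
  fix x assume "x \<in> Rf f"
  then obtain g a b where "x = to_fract g / (t ^ a * ft ^ b)" unfolding mem_Rf_iff by blast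
  then have "- x = to_fract (- g) / (t ^ a * ft ^ b)" by simp
  then show "- x \<in> Rf f" unfolding mem_Rf_iff by blast
qed

text \<open>If \<open>w v = 1\<close>, clearing denominators makes the product of the numerators a
  monomial in \<open>X\<close> and \<open>f\<close>, so the numerator of \<open>w\<close> is one as
  well.\<close>

lemma ring_units_Rf: "w \<in> ring_units (Rf f) \<longleftrightarrow> (\<exists>i j. w = t powi i * ft powi j)"
proof
  assume "w \<in> ring_units (Rf f)"
  then obtain v where "w \<in> Rf f" "v \<in> Rf f" and wv: "w * v = 1" by (auto simp: ring_units_def)
  then obtain g a b h c d where w: "w = to_fract g / (t ^ a * ft ^ b)" and v: "v = to_fract h / (t ^ c * ft ^ d)"
    unfolding mem_Rf_iff by blast
  have "to_fract (g * h) = to_fract (X ^ (a + c) * f ^ (b + d))"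
    using wv t_nz ft_nz by (simp add: w v to_fract_power power_add field_simps)
  then have "g * h = X ^ (a + c) * f ^ (b + d)" by (simp only: to_fract_eq_iff)
  then obtain i j where g: "g = X ^ i * f ^ j" by (rule divisor_of_monomial)
  have "w = t powi (int i - int a) * ft powi (int j - int b)"
    using t_nz ft_nz by (simp add: w g to_fract_power power_int_diff)
  then show "\<exists>i j. w = t powi i * ft powi j" by blast
next
  assume "\<exists>i j. w = t powi i * ft powi j"
  then obtain i j where w: "w = t powi i * ft powi j" by blast
  have in_R: "t powi i * ft powi j \<in> Rf f" for i j
  proof -
    have "t powi i * ft powi j = to_fract (num i j) / (t ^ nat (- i) * ft ^ nat (- j))"
      by (simp add: unit_eq_quotient) (simp add: num_def to_fract_power)
    then show ?thesis unfolding mem_Rf_iff by blast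
  qed
  have "w * (t powi (- i) * ft powi (- j)) = 1"
    using t_nz ft_nz by (simp add: w power_int_minus field_simps)
  then show "w \<in> ring_units (Rf f)" using in_R w by (auto simp: ring_units_def)
qed

text \<open>For \<open>s = 1/t\<close> the numerator of \<open>f(s)\<close> is the reciprocal
  polynomial \<open>t^m f(1/t)\<close>.\<close>

lemma reciprocal_neq_f: "homog (- 1) 0 \<noteq> f"
proof
  assume "homog (- 1) 0 = f"
  moreover have "homog (- 1) 0 = (\<Sum>k\<in>supp. X ^ (degree f - k))"
    by (simp add: homog_def num_def)
  moreover have "\<dots> = (\<Sum>i\<le>degree f. monom (coeff f i) (degree f - i))"
    unfolding sum_supp by (intro sum.cong refl) (auto simp: monom_altdef)
  ultimately show False using not_self_reciprocal_f by (simp add: self_reciprocal_def)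
qed

text \<open>Such an \<open>F\<close> is \<open>F 1\<close> times a ring automorphism of \<open>R\<^sub>f\<close> extending \<open>\<alpha>\<close>, so this says that
  \<open>R\<^sub>f\<close> has no nontrivial automorphisms.\<close>

lemma semilinear_imp_trivial:
  assumes add: "\<And>r s. r \<in> Rf f \<Longrightarrow> s \<in> Rf f \<Longrightarrow> F (r + s) = F r + F s"
    and inj: "\<And>r. r \<in> Rf f \<Longrightarrow> F r = (0 :: bit poly fract) \<Longrightarrow> r = 0"
    and semilinear: "\<And>w r. w \<in> ring_units (Rf f) \<Longrightarrow> r \<in> Rf f \<Longrightarrow> F (w * r) = \<alpha> w * F r"
    and units: "\<alpha> ` ring_units (Rf f) = ring_units (Rf f)"
    and w: "w \<in> ring_units (Rf f)"
  shows "\<alpha> w = w"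
proof -
  interpret subring_of_field "Rf f" by (rule Rf_subring)
  have F1: "F 1 \<noteq> 0" using inj[OF one_R] by auto
  have F_eq: "F w = \<alpha> w * F 1" if "w \<in> ring_units (Rf f)" for w
    using semilinear[OF that one_R] by simp
  have \<alpha>_mult: "\<alpha> (v * w) = \<alpha> v * \<alpha> w" if "v \<in> ring_units (Rf f)" "w \<in> ring_units (Rf f)" for v w
    using F_eq[OF ring_units_mult[OF that]] semilinear[OF that(1) ring_units_in_R[OF that(2)]]
      F_eq[OF that(2)] F1 by simp
  have \<alpha>_1: "\<alpha> 1 = 1" using F_eq[OF ring_units_one] F1 by simp
  have unit_power: "w ^ k \<in> ring_units (Rf f)" if "w \<in> ring_units (Rf f)" for w k
    using that by (induction k) (auto intro: ring_units_one ring_units_mult)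
  have \<alpha>_power: "\<alpha> (w ^ k) = \<alpha> w ^ k" if "w \<in> ring_units (Rf f)" for w k
    by (induction k) (use that \<alpha>_1 \<alpha>_mult unit_power in auto)
  have \<alpha>_inverse: "\<alpha> (inverse w) = inverse (\<alpha> w)" if "w \<in> ring_units (Rf f)" for w
    using \<alpha>_mult[OF that ring_units_inverse[OF that]] ring_units_nz[OF that] \<alpha>_1
      inverse_unique[of "\<alpha> w" "\<alpha> (inverse w)"] by simp
  have \<alpha>_powi: "\<alpha> (w powi k) = \<alpha> w powi k" "w powi k \<in> ring_units (Rf f)"
    if "w \<in> ring_units (Rf f)" for w k
    using that unit_power ring_units_inverse
    by (auto simp: power_int_def \<alpha>_power \<alpha>_inverse)
  have t: "t \<in> ring_units (Rf f)"
    unfolding ring_units_Rf by (intro exI[of _ 1] exI[of _ 0]) simp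
  have ft: "ft \<in> ring_units (Rf f)"
    unfolding ring_units_Rf by (intro exI[of _ 0] exI[of _ 1]) simp
  have F0: "F 0 = 0" using add[OF zero_R zero_R] by (simp only: add_0_right add_cancel_right_right)
  have F_sum: "F (sum h A) = (\<Sum>k\<in>A. F (h k)) \<and> sum h A \<in> Rf f"
    if "finite A" "\<And>k. h k \<in> Rf f" for h and A :: "nat set"
    using that(1) by induction (use that(2) F0 add in \<open>auto intro: zero_R add_R\<close>)
  \<comment> \<open>Applying the additive \<open>F\<close> to \<open>f = \<Sum> t^k\<close> gives
    \<open>\<alpha> ft = f(\<alpha> t)\<close>, which ties the two generators of the unit group
    together.\<close>
  have "F ft = F (\<Sum>k\<in>supp. t ^ k)"
    using arg_cong[OF f_eq_sum, of to_fract] by (simp add: to_fract_sum to_fract_power)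
  also have "\<dots> = (\<Sum>k\<in>supp. \<alpha> t ^ k) * F 1"
    using F_sum[OF finite_supp, of "\<lambda>k. t ^ k"] ring_units_in_R[OF unit_power[OF t]]
    by (simp add: F_eq[OF unit_power[OF t]] \<alpha>_power[OF t] sum_distrib_right)
  finally have \<alpha>_ft: "\<alpha> ft = (\<Sum>k\<in>supp. \<alpha> t ^ k)"
    using F_eq[OF ft] F1 by simp
  obtain i j where ij: "\<alpha> t = t powi i * ft powi j"
    using units t ring_units_Rf by blast
  obtain a b where "\<alpha> ft = t powi a * ft powi b"
    using units ft ring_units_Rf by blast
  then have "(\<Sum>k\<in>supp. (t powi i * ft powi j) ^ k) = t powi a * ft powi b"
    using \<alpha>_ft ij by simp
  then obtain l where l: "homog i j = f ^ l" by (rule homog_eq_power)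
  then have j: "j = 0" by (rule exponent_f_eq_0)
  \<comment> \<open>The denominator of \<open>f(t^i)\<close> is \<open>t^c\<close>, so
    \<open>\<alpha> ft = ft^l t^(-c)\<close>; by construction \<open>i\<close> divides
    \<open>c\<close>.\<close>
  define c where "c = int (nat (- i) * degree f)"
  have \<alpha>_t: "\<alpha> t = t powi i" using ij j by simp
  have "t powi (- c) = inverse ((t ^ nat (- i)) ^ degree f)"
    by (simp only: c_def power_int_minus power_int_of_nat power_mult)
  then have \<alpha>_ft': "\<alpha> ft = ft powi int l * t powi (- c)"
    unfolding \<alpha>_ft ij sum_powers_unit l
    by (simp add: j num_def to_fract_power divide_inverse)
  have \<alpha>_unit: "\<alpha> (t powi x * ft powi y) = t powi (i * x - c * y) * ft powi (int l * y)" for x y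
  proof -
    have "\<alpha> (t powi x * ft powi y) = (t powi i) powi x * (ft powi int l * t powi (- c)) powi y"
      using \<alpha>_mult[OF \<alpha>_powi(2)[OF t] \<alpha>_powi(2)[OF ft]] \<alpha>_powi(1)[OF t] \<alpha>_powi(1)[OF ft]
      by (simp only: \<alpha>_t \<alpha>_ft')
    also have "\<dots> = t powi (i * x) * t powi (- c * y) * ft powi (int l * y)"
      unfolding power_int_mult_distrib power_int_mult by (simp only: mult_ac)
    also have "\<dots> = t powi (i * x - c * y) * ft powi (int l * y)"
      using t_nz power_int_add[of t "i * x" "- c * y"] by simp
    finally show ?thesis .
  qed
  \<comment> \<open>On exponents \<open>\<alpha>\<close> is a triangular integer matrix. That
    \<open>t\<close> is in its image, together with \<open>i dvd c\<close>, forces \<open>i\<close>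
    to be 1 or -1.\<close>
  obtain x y where "\<alpha> (t powi x * ft powi y) = t"
    using units t ring_units_Rf by (metis (no_types, lifting) imageE)
  then have "t powi (i * x - c * y) * ft powi (int l * y) / t = 1"
    using t_nz \<alpha>_unit by simp
  then have "t powi (i * x - c * y - 1) * ft powi (int l * y) = 1"
    using t_nz by (simp add: power_int_diff)
  then have "i * x - c * y = 1" unfolding unit_eq_1_iff by simp
  moreover have "i dvd c" by (auto simp: c_def)
  ultimately have "i dvd 1" by (metis dvd_diff dvd_mult2 dvd_triv_left)
  then consider "i = 1" | "i = - 1" by fastforce
  then show ?thesis
  proof cases
    case 1
    then have "homog i j = f"
      using f_eq_sum by (simp add: homog_def num_def j)
    then have "f ^ l = f" using l by simp
    then have "degree (f ^ l) = degree f" by simp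
    then have "l = 1" using degree_f f_nz by (simp add: degree_power_eq)
    obtain x y where "w = t powi x * ft powi y" using w ring_units_Rf by blast
    then show ?thesis using \<alpha>_unit[of x y] 1 \<open>l = 1\<close> by (simp add: c_def)
  next
    case 2
    \<comment> \<open>Here \<open>\<alpha>\<close> would exchange 0 and infinity. The reciprocal
      polynomial has the degree of \<open>f\<close>, so being a power of \<open>f\<close> it equals
      \<open>f\<close>.\<close>
    have eq: "homog (- 1) 0 = f ^ l" using l 2 j by simp
    have "max (degree (num (- 1) 0)) (degree (num (- (- 1)) (- 0))) = 1"
      by (simp add: num_def)
    then have "coeff (homog (- 1) 0) (degree f * 1) = 1"
      by (intro coeff_homog) simp
    moreover have "degree (homog (- 1) 0) \<le> degree f"
      unfolding homog_def by (intro degree_sum_le finite_supp) (simp add: num_def degree_power_eq)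
    ultimately have "degree (homog (- 1) 0) = degree f"
      using le_degree[of "homog (- 1) 0" "degree f"] by simp
    then have "l = 1" unfolding eq using degree_f f_nz by (simp add: degree_power_eq)
    then show ?thesis using eq reciprocal_neq_f by simp
  qed
qed

section \<open>Invariance of the character under automorphisms\<close>

lemma root_ratio_invariant:
  assumes phi: "\<phi> \<in> iso (quo4 (Rf f)) (quo4 (Rf f))" and x: "x \<in> carrier (quo4 (Rf f))"
  shows "root_ratio (\<phi> x) = root_ratio x"
proof -
  interpret subring_of_field "Rf f" by (rule Rf_subring)
  let ?G = "quo4 (Rf f)" and ?U = "ring_units (Rf f)"
  have "(2 :: bit poly) = 0"
    by (simp add: numeral_poly)
  then have char2: "(2 :: bit poly fract) = 0"
    using to_fract_add[of "1 :: bit poly" 1] by simp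
  have t: "t \<in> ?U"
    unfolding ring_units_Rf by (intro exI[of _ 1] exI[of _ 0]) simp
  have "t \<noteq> 1"
    using unit_eq_1_iff[of 1 0] by simp
  obtain F where F: "\<And>r s. r \<in> Rf f \<Longrightarrow> s \<in> Rf f \<Longrightarrow> F (r + s) = F r + F s"
    "\<And>r. r \<in> Rf f \<Longrightarrow> F r = 0 \<Longrightarrow> r = 0"
    "\<And>x r. x \<in> carrier ?G \<Longrightarrow> r \<in> Rf f \<Longrightarrow> F (root_ratio x * r) = root_ratio (\<phi> x) * F r"
    using quo4_automorphism_semilinear[OF char2 phi t \<open>t \<noteq> 1\<close>] by blast
  have F1: "F 1 \<noteq> 0" using F(2)[OF one_R] by auto
  have bij: "bij_betw \<phi> (carrier ?G) (carrier ?G)" using phi by (simp add: iso_def)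
  \<comment> \<open>A section of the character, by the matrices
    \<open>diag(1, w, 1, 1)\<close>.\<close>
  define \<delta> where "\<delta> w = (w, 1 :: bit poly fract, 0 :: bit poly fract, 0 :: bit poly fract,
    0 :: bit poly fract, 0 :: bit poly fract, 0 :: bit poly fract)" for w :: "bit poly fract"
  have \<delta>: "\<delta> w \<in> carrier ?G" "root_ratio (\<delta> w) = w" if "w \<in> ?U" for w
    using that by (simp_all add: \<delta>_def root_ratio_simps R_closed)
  have ratio_unit: "root_ratio y \<in> ?U" if "y \<in> carrier ?G" for y
    using that by (auto simp: root_ratio_simps divide_inverse R_closed)
  define \<alpha> where "\<alpha> w = root_ratio (\<phi> (\<delta> w))" for w
  have \<alpha>: "F (w * r) = \<alpha> w * F r" if "w \<in> ?U" "r \<in> Rf f" for w r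
    using F(3)[OF \<delta>(1)[OF that(1)] that(2)] \<delta>(2)[OF that(1)] by (simp add: \<alpha>_def)
  \<comment> \<open>Evaluating \<open>F (root_ratio y)\<close> in two ways shows that the ratio of
    \<open>\<phi> y\<close> depends only on that of \<open>y\<close>, so \<open>\<phi>\<close>
    induces \<open>\<alpha>\<close> on the units.\<close>
  have \<alpha>_ratio: "\<alpha> (root_ratio y) = root_ratio (\<phi> y)" if "y \<in> carrier ?G" for y
    using F(3)[OF that one_R] \<alpha>[OF ratio_unit[OF that] one_R] F1 by simp
  have phi_closed: "\<phi> y \<in> carrier ?G" if "y \<in> carrier ?G" for y
    using bij_betwE[OF bij] that by blast
  have "\<alpha> ` ?U = ?U"
  proof (intro equalityI subsetI)
    fix v assume "v \<in> \<alpha> ` ?U"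
    then show "v \<in> ?U" using ratio_unit phi_closed \<delta>(1) unfolding \<alpha>_def by blast
  next
    fix v assume v: "v \<in> ?U"
    then have "\<delta> v \<in> \<phi> ` carrier ?G"
      using \<delta>(1) bij_betw_imp_surj_on[OF bij] by simp
    then obtain y where y: "y \<in> carrier ?G" "\<delta> v = \<phi> y" by blast
    then have "v = \<alpha> (root_ratio y)" using \<alpha>_ratio \<delta>(2)[OF v] by simp
    then show "v \<in> \<alpha> ` ?U" using ratio_unit[OF y(1)] by blast
  qed
  then have "\<alpha> (root_ratio x) = root_ratio x"
    using semilinear_imp_trivial[of F \<alpha>] F(1,2) \<alpha> ratio_unit[OF x] by blast
  then show ?thesis using \<alpha>_ratio[OF x] by simp
qed

end

theorem mainTheorem16:
  fixes f :: "bit poly"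
  assumes "irreducible f"
    and "f \<noteq> [:0, 1:]"
    and "\<not> self_reciprocal f"
  shows "R_infinity (A4 (Rf f) Mod group_center (U4 (Rf f)))"
proof -
  interpret non_self_reciprocal f by unfold_locales (use assms in auto)
  interpret subring_of_field "Rf f" by (rule Rf_subring)
  let ?Q = "A4 (Rf f) Mod group_center (U4 (Rf f))"
  obtain \<psi> where psi: "\<psi> \<in> iso ?Q (quo4 (Rf f))" and Q: "group ?Q"
    by (rule A4_quotient_iso)
  have hom: "\<psi> \<in> hom ?Q (quo4 (Rf f))" using psi by (simp add: iso_def)
  have closed: "\<psi> x \<in> carrier (quo4 (Rf f))" if "x \<in> carrier ?Q" for x
    using hom_in_carrier[OF hom that] .
  show ?thesis
  proof (rule R_infinityI[OF Q, where \<chi> = "\<lambda>x. root_ratio (\<psi> x)"])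
    fix x y assume xy: "x \<in> carrier ?Q" "y \<in> carrier ?Q"
    have "root_ratio (quo_mult p q) = root_ratio p * root_ratio q" for p q :: "bit poly fract \<times> _"
      by (cases p rule: prod_cases7, cases q rule: prod_cases7)
        (simp add: quo_mult_simps root_ratio_simps)
    then show "root_ratio (\<psi> (x \<otimes>\<^bsub>?Q\<^esub> y)) = root_ratio (\<psi> x) * root_ratio (\<psi> y)"
      using hom_mult[OF hom xy] by simp
  next
    fix x assume "x \<in> carrier ?Q"
    from closed[OF this] show "root_ratio (\<psi> x) \<noteq> 0"
      by (auto simp: root_ratio_simps dest: ring_units_nz)
  next
    have "range (\<lambda>k. t ^ k) \<subseteq> (\<lambda>x. root_ratio (\<psi> x)) ` carrier ?Q"
    proof
      fix v assume "v \<in> range (\<lambda>k. t ^ k)"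
      then obtain k where k: "v = t ^ k" by blast
      have "v \<in> ring_units (Rf f)"
        unfolding ring_units_Rf k by (intro exI[of _ "int k"] exI[of _ 0]) simp
      then have "(v, 1, 0, 0, 0, 0, 0) \<in> carrier (quo4 (Rf f))" by (simp add: R_closed)
      also have "carrier (quo4 (Rf f)) = \<psi> ` carrier ?Q"
        using psi by (simp add: iso_def bij_betw_def)
      finally obtain x where "x \<in> carrier ?Q" "\<psi> x = (v, 1, 0, 0, 0, 0, 0)" by force
      then show "v \<in> (\<lambda>x. root_ratio (\<psi> x)) ` carrier ?Q"
        by (intro rev_image_eqI[of x]) (simp_all add: root_ratio_simps)
    qed
    moreover have "inj (\<lambda>k. t ^ k)"
    proof (rule injI)
      fix k l assume "t ^ k = t ^ l"
      then have "t powi (int k - int l) * ft powi 0 = 1"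
        using t_nz by (simp add: power_int_diff)
      then show "k = l" unfolding unit_eq_1_iff by simp
    qed
    ultimately show "infinite ((\<lambda>x. root_ratio (\<psi> x)) ` carrier ?Q)"
      using range_inj_infinite infinite_super by blast
  next
    fix \<phi> x assume phi: "\<phi> \<in> iso ?Q ?Q" and x: "x \<in> carrier ?Q"
    let ?inv = "inv_into (carrier ?Q) \<psi>"
    \<comment> \<open>Conjugating by \<open>\<psi>\<close> transports the automorphism to
      \<open>quo4\<close>, where the invariance is known.\<close>
    have "?inv \<in> iso (quo4 (Rf f)) ?Q" by (rule group.iso_set_sym[OF Q psi])
    then have "(\<psi> \<circ> \<phi>) \<circ> ?inv \<in> iso (quo4 (Rf f)) (quo4 (Rf f))"
      using iso_set_trans[OF _ iso_set_trans[OF phi psi]] by blast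
    from root_ratio_invariant[OF this closed[OF x]]
    have "root_ratio (((\<psi> \<circ> \<phi>) \<circ> ?inv) (\<psi> x)) = root_ratio (\<psi> x)" .
    moreover have "?inv (\<psi> x) = x"
      using psi x by (simp add: iso_def bij_betw_def)
    ultimately show "root_ratio (\<psi> (\<phi> x)) = root_ratio (\<psi> x)" by simp
  qed
qed

end
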